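(* $\mathrm{BMO}=\Lambda$. More precisely, if $\varphi\in\mathrm{BMO}$, then $\varphi\in\Lambda$ and $\|\varphi\|_\Lambda\le\|\varphi\|_*$. Also, there is an absolute constant $c$ such that if $\varphi\in\Lambda$, then $\varphi\in\mathrm{BMO}$ and $\|\varphi\|_*\le c\,\|\varphi\|_\Lambda$.
   Context: All functions are on $\mathbb{R}$. For locally integrable $\varphi$ and a bounded interval $I$ let $\varphi_I=\frac1{|I|}\int_I\varphi$. $\mathrm{BMO}$ is the space of locally integrable $\varphi$ with $\|\varphi\|_*=\sup_I\frac1{|I|}\int_I|\varphi(x)-\varphi_I|\,dx<\infty$, the supremum being over all bounded intervals. $\mathrm{BMO}_d$ (dyadic BMO) is defined in the same way with the supremum, denoted $\|\varphi\|_{*,d}$, restricted to dyadic intervals $[k2^n,(k+1)2^n)$, $k,n\in\mathbb{Z}$. For locally integrable $\varphi$ put $$A(\varphi)=\sup_{n,k\in\mathbb{Z}}\frac1{2^{n+1}}\Big|\int_{[(k-1)2^n,\,k2^n]}\varphi(x)\,dx-\int_{[k2^n,\,(k+1)2^n]}\varphi(x)\,dx\Big|,$$ and $\Lambda=\{\varphi\in\mathrm{BMO}_d:A(\varphi)<\infty\}$, $\|\varphi\|_\Lambda=\max(\|\varphi\|_{*,d},A(\varphi))$. *)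

theory Defs
  imports "HOL-Analysis.Analysis"
begin

text \<open>
  Integrals are with respect to Lebesgue measure (the completion of \<open>lborel\<close>), so local
  integrability means Lebesgue measurable and integrable on every compact set. Functions are
  honest functions, not classes modulo null sets. All suprema are taken in \<open>ennreal\<close>,
  so they exist unconditionally and finiteness is a separate, explicit condition.
\<close>

definition locally_integrable :: "(real \<Rightarrow> real) \<Rightarrow> bool" where
  "locally_integrable \<phi> \<longleftrightarrow> (\<forall>K. compact K \<longrightarrow> set_integrable lebesgue K \<phi>)"

text \<open>
  Open, closed and half-open intervals are all admitted; empty intervals and single points are
  excluded because averages over them are not defined.
\<close>

definition bounded_intervals :: "real set set" where
  "bounded_intervals = {I. is_interval I \<and> bounded I \<and> 0 < measure lebesgue I}"

definition dyadic_intervals :: "real set set" where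
  "dyadic_intervals =
     {{of_int k * 2 powi n ..< (of_int k + 1) * 2 powi n} | (k::int) (n::int). True}"

definition interval_average :: "real set \<Rightarrow> (real \<Rightarrow> real) \<Rightarrow> real" where
  "interval_average I \<phi> = (1 / measure lebesgue I) * (LINT x:I|lebesgue. \<phi> x)"

definition mean_oscillation :: "real set \<Rightarrow> (real \<Rightarrow> real) \<Rightarrow> real" where
  "mean_oscillation I \<phi> = interval_average I (\<lambda>x. \<bar>\<phi> x - interval_average I \<phi>\<bar>)"

definition bmo_norm :: "(real \<Rightarrow> real) \<Rightarrow> ennreal" where
  "bmo_norm \<phi> = (SUP I\<in>bounded_intervals. ennreal (mean_oscillation I \<phi>))"

definition dyadic_bmo_norm :: "(real \<Rightarrow> real) \<Rightarrow> ennreal" where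
  "dyadic_bmo_norm \<phi> = (SUP I\<in>dyadic_intervals. ennreal (mean_oscillation I \<phi>))"

definition BMO :: "(real \<Rightarrow> real) set" where
  "BMO = {\<phi>. locally_integrable \<phi> \<and> bmo_norm \<phi> < \<infinity>}"

definition dyadic_BMO :: "(real \<Rightarrow> real) set" where
  "dyadic_BMO = {\<phi>. locally_integrable \<phi> \<and> dyadic_bmo_norm \<phi> < \<infinity>}"

text \<open>
  The two intervals below are adjacent and of equal length, but need not be the two halves of a
  dyadic interval.
\<close>

definition adjacent_diff :: "(real \<Rightarrow> real) \<Rightarrow> ennreal" where
  "adjacent_diff \<phi> = (SUP (n::int, k::int)\<in>UNIV. ennreal (1 / 2 powi (n + 1) *
     \<bar>(LINT x:{(of_int k - 1) * 2 powi n .. of_int k * 2 powi n}|lebesgue. \<phi> x)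
      - (LINT x:{of_int k * 2 powi n .. (of_int k + 1) * 2 powi n}|lebesgue. \<phi> x)\<bar>))"

definition Lambda_space :: "(real \<Rightarrow> real) set" where
  "Lambda_space = {\<phi> \<in> dyadic_BMO. adjacent_diff \<phi> < \<infinity>}"

definition Lambda_norm :: "(real \<Rightarrow> real) \<Rightarrow> ennreal" where
  "Lambda_norm \<phi> = max (dyadic_bmo_norm \<phi>) (adjacent_diff \<phi>)"

end

theory Submission
  imports Defs
begin

text \<open>
  The mean oscillation over \<open>I\<close> is, up to a factor \<open>2\<close>, the smallest average of \<open>\<bar>\<phi> - c\<bar>\<close> over
  \<open>I\<close> as \<open>c\<close> ranges over the constants (\<open>mean_oscillation_le_any_constant\<close>); this allows the
  average to be replaced by a more convenient constant.

  For \<open>\<phi>\<close> in BMO, two adjacent intervals of length \<open>h\<close> form an interval \<open>S\<close> of length \<open>2h\<close>.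
  Subtracting the average over \<open>S\<close> from \<open>\<phi>\<close> does not affect the difference of the two integrals,
  so this difference is at most the integral over \<open>S\<close> of \<open>\<bar>\<phi> - \<phi>\<^sub>S\<bar>\<close>, which is \<open>2h\<close> times the
  mean oscillation over \<open>S\<close> (\<open>adjacent_diff_le_mean_oscillation\<close>).

  Conversely, every bounded interval \<open>I\<close> lies in the union of two adjacent dyadic intervals
  \<open>J\<close> and \<open>K\<close> of common length less than \<open>2\<bar>I\<bar>\<close> (\<open>interval_subset_adjacent_dyadic\<close>). On \<open>J\<close>
  and \<open>K\<close> the function is close in mean to \<open>\<phi>\<^sub>J\<close> and \<open>\<phi>\<^sub>K\<close>, and these two averages differ by at
  most \<open>2 A(\<phi>)\<close>. So \<open>\<phi>\<close> is close in mean to the single constant \<open>\<phi>\<^sub>J\<close> on \<open>J \<union> K\<close>, hence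
  on \<open>I\<close>. The resulting constant is \<open>16\<close>.
\<close>

section \<open>Integrals over subsets of the line\<close>

lemma abs_set_integral_le:
  fixes f :: "real \<Rightarrow> real"
  shows "\<bar>LINT x:A|M. f x\<bar> \<le> (LINT x:A|M. \<bar>f x\<bar>)"
proof -
  have "(LINT x:A|M. \<bar>f x\<bar>) = (\<integral>x. \<bar>indicator A x *\<^sub>R f x\<bar> \<partial>M)"
    unfolding set_lebesgue_integral_def by (simp add: abs_mult)
  then show ?thesis
    unfolding set_lebesgue_integral_def by (simp add: integral_abs_bound del: real_scaleR_def)
qed

lemma set_integral_mono_subset:
  fixes f :: "real \<Rightarrow> real"
  assumes "set_integrable M A f" "B \<in> sets M" "B \<subseteq> A" "\<And>x. x \<in> A \<Longrightarrow> 0 \<le> f x"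
  shows "(LINT x:B|M. f x) \<le> (LINT x:A|M. f x)"
proof -
  have "set_integrable M B f"
    using assms set_integrable_subset by blast
  then show ?thesis
    using assms unfolding set_integrable_def set_lebesgue_integral_def
    by (intro integral_mono) (auto split: split_indicator)
qed

lemma set_integrable_const_lmeasurable:
  "A \<in> lmeasurable \<Longrightarrow> set_integrable lebesgue A (\<lambda>x. c::real)"
  by (auto simp: set_integrable_def fmeasurable_def)

lemma set_integral_const_lmeasurable:
  "A \<in> lmeasurable \<Longrightarrow> (LINT x:A|lebesgue. (c::real)) = measure lebesgue A * c"
  by (subst set_integral_const) (auto simp: fmeasurable_def)

lemma set_integral_Icc_eq_Ico:
  fixes f :: "real \<Rightarrow> real"
  shows "(LINT x:{a..b}|lebesgue. f x) = (LINT x:{a..<b}|lebesgue. f x)"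
  by (rule set_integral_discrete_difference[where X="{b}"]) auto

lemma locally_integrable_bounded:
  assumes "locally_integrable \<phi>" "S \<in> sets lebesgue" "bounded S"
  shows "set_integrable lebesgue S \<phi>"
proof -
  obtain a b where "S \<subseteq> {a..b}"
    using assms(3) bounded_subset_cbox_symmetric by (metis cbox_interval)
  moreover have "set_integrable lebesgue {a..b} \<phi>"
    using assms(1) by (simp add: locally_integrable_def)
  ultimately show ?thesis
    using assms(2) set_integrable_subset by blast
qed

section \<open>Mean oscillation\<close>

lemma mean_oscillation_alt:
  "mean_oscillation S \<phi>
     = (LINT x:S|lebesgue. \<bar>\<phi> x - interval_average S \<phi>\<bar>) / measure lebesgue S"
  by (simp add: mean_oscillation_def interval_average_def[of S "\<lambda>x. \<bar>\<phi> x - _\<bar>"])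

lemma set_integrable_abs_diff_const:
  assumes "set_integrable lebesgue S \<phi>" "S \<in> lmeasurable"
  shows "set_integrable lebesgue S (\<lambda>x. \<bar>\<phi> x - (c::real)\<bar>)"
  using assms by (intro set_integrable_abs set_integral_diff set_integrable_const_lmeasurable)

lemma set_integral_diff_const:
  assumes "set_integrable lebesgue S \<phi>" "S \<in> lmeasurable"
  shows "(LINT x:S|lebesgue. \<phi> x - (c::real)) = (LINT x:S|lebesgue. \<phi> x) - measure lebesgue S * c"
  using assms
  by (simp add: set_integral_diff set_integrable_const_lmeasurable set_integral_const_lmeasurable)

lemma set_integral_abs_diff_triangle:
  fixes \<phi> :: "real \<Rightarrow> real"
  assumes "set_integrable lebesgue S \<phi>" "S \<in> lmeasurable"
  shows "(LINT x:S|lebesgue. \<bar>\<phi> x - d\<bar>)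
           \<le> (LINT x:S|lebesgue. \<bar>\<phi> x - c\<bar>) + measure lebesgue S * \<bar>c - d\<bar>"
proof -
  have "(LINT x:S|lebesgue. \<bar>\<phi> x - d\<bar>) \<le> (LINT x:S|lebesgue. \<bar>\<phi> x - c\<bar> + \<bar>c - d\<bar>)"
    using assms
    by (intro set_integral_mono set_integral_add set_integrable_abs_diff_const
        set_integrable_const_lmeasurable) auto
  also have "\<dots> = (LINT x:S|lebesgue. \<bar>\<phi> x - c\<bar>) + measure lebesgue S * \<bar>c - d\<bar>"
    using assms
    by (simp add: set_integral_add set_integrable_abs_diff_const
        set_integrable_const_lmeasurable set_integral_const_lmeasurable)
  finally show ?thesis .
qed

lemma mean_oscillation_le_any_constant:
  fixes \<phi> :: "real \<Rightarrow> real"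
  assumes "set_integrable lebesgue S \<phi>" "S \<in> lmeasurable" "0 < measure lebesgue S"
  shows "mean_oscillation S \<phi> \<le> 2 / measure lebesgue S * (LINT x:S|lebesgue. \<bar>\<phi> x - c\<bar>)"
proof -
  let ?m = "measure lebesgue S" and ?d = "interval_average S \<phi>"
  let ?L = "LINT x:S|lebesgue. \<bar>\<phi> x - c\<bar>"
  have "?m * \<bar>c - ?d\<bar> = \<bar>?m * ?d - ?m * c\<bar>"
    using assms(3) by (metis abs_minus_commute abs_mult abs_of_pos right_diff_distrib)
  also have "\<dots> = \<bar>LINT x:S|lebesgue. \<phi> x - c\<bar>"
    using assms by (simp add: set_integral_diff_const interval_average_def del: set_integral_diff)
  also have "\<dots> \<le> ?L"
    by (rule abs_set_integral_le)
  finally have "(LINT x:S|lebesgue. \<bar>\<phi> x - ?d\<bar>) \<le> 2 * ?L"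
    using set_integral_abs_diff_triangle[OF assms(1,2), of ?d c] by linarith
  then show ?thesis
    using assms(3) by (simp add: mean_oscillation_alt divide_right_mono)
qed

section \<open>Differences of averages over adjacent intervals\<close>

lemma adjacent_diff_le_mean_oscillation:
  assumes "locally_integrable \<phi>" "0 < h"
  shows "1 / (2 * h) * \<bar>(LINT x:{a - h..a}|lebesgue. \<phi> x) - (LINT x:{a..a + h}|lebesgue. \<phi> x)\<bar>
           \<le> mean_oscillation {a - h..<a + h} \<phi>"
proof -
  let ?J = "{a - h..<a}" and ?K = "{a..<a + h}" and ?S = "{a - h..<a + h}"
  let ?m = "interval_average ?S \<phi>"
  have int: "set_integrable lebesgue {u..<v} \<phi>" for u v
    by (rule locally_integrable_bounded[OF assms(1)]) auto
  have fin: "{u..<v} \<in> lmeasurable" for u v :: real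
    by (rule measurable_convex) auto
  \<comment> \<open>The two intervals have equal length, so subtracting a constant changes nothing.\<close>
  have "\<bar>(LINT x:?J|lebesgue. \<phi> x) - (LINT x:?K|lebesgue. \<phi> x)\<bar>
      = \<bar>(LINT x:?J|lebesgue. \<phi> x - ?m) - (LINT x:?K|lebesgue. \<phi> x - ?m)\<bar>"
    using assms(2) by (simp add: set_integral_diff_const int fin del: set_integral_diff)
  also have "\<dots> \<le> (LINT x:?J|lebesgue. \<bar>\<phi> x - ?m\<bar>) + (LINT x:?K|lebesgue. \<bar>\<phi> x - ?m\<bar>)"
    using abs_set_integral_le[of lebesgue ?J "\<lambda>x. \<phi> x - ?m"]
      abs_set_integral_le[of lebesgue ?K "\<lambda>x. \<phi> x - ?m"] by linarith
  also have "\<dots> = (LINT x:?J \<union> ?K|lebesgue. \<bar>\<phi> x - ?m\<bar>)"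
    by (rule set_integral_Un[symmetric]) (auto intro: set_integrable_abs_diff_const int fin)
  also have "?J \<union> ?K = ?S"
    using assms(2) by auto
  finally show ?thesis
    using assms(2) by (simp add: set_integral_Icc_eq_Ico mean_oscillation_alt divide_right_mono)
qed

section \<open>Covering an interval by two adjacent dyadic intervals\<close>

lemma bounded_intervals_lmeasurable: "I \<in> bounded_intervals \<Longrightarrow> I \<in> lmeasurable"
  by (simp add: bounded_intervals_def is_interval_convex measurable_convex)

lemma Ico_in_bounded_intervals: "a < b \<Longrightarrow> {a..<b} \<in> bounded_intervals"
  by (simp add: bounded_intervals_def)

lemma dyadic_intervals_subset_bounded_intervals: "dyadic_intervals \<subseteq> bounded_intervals"
  by (auto simp: dyadic_intervals_def intro!: Ico_in_bounded_intervals mult_strict_right_mono)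

lemma bounded_interval_subset_Icc:
  assumes "I \<in> bounded_intervals"
  obtains a where "I \<subseteq> {a..a + measure lebesgue I}"
proof
  have I: "is_interval I" "bounded I" "I \<noteq> {}"
    using assms by (auto simp: bounded_intervals_def)
  have bdd: "bdd_below I" "bdd_above I"
    using I by (simp_all add: bounded_imp_bdd_below bounded_imp_bdd_above)
  have "{Inf I<..<Sup I} \<subseteq> I"
  proof
    fix x assume "x \<in> {Inf I<..<Sup I}"
    then obtain y z where "y \<in> I" "y < x" "z \<in> I" "x < z"
      using I(3) bdd by (auto simp: cInf_less_iff less_cSup_iff)
    then show "x \<in> I"
      using I(1) by (meson is_interval_1 less_imp_le)
  qed
  then have "measure lebesgue {Inf I<..<Sup I} \<le> measure lebesgue I"
    using bounded_intervals_lmeasurable[OF assms] by (intro measure_mono_fmeasurable) auto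
  moreover have "Inf I \<le> Sup I"
    using I(3) bdd by (simp add: cInf_le_cSup)
  ultimately have "Sup I \<le> Inf I + measure lebesgue I"
    by simp
  then show "I \<subseteq> {Inf I..Inf I + measure lebesgue I}"
    using bdd by (force intro: cInf_lower order_trans[OF cSup_upper])
qed

lemma power_of_two_between:
  fixes L :: real
  assumes "0 < L"
  obtains n :: int where "L \<le> 2 powi n" "2 powi n < 2 * L"
proof
  let ?n = "\<lceil>log 2 L\<rceil>"
  have eq: "2 powi ?n = (2::real) powr of_int ?n"
    by (simp add: powr_real_of_int')
  show "L \<le> 2 powi ?n"
    unfolding eq using assms by (simp add: le_powr_iff)
  have "of_int ?n < log 2 (2 * L)"
    using assms by (simp add: log_mult) linarith
  then show "2 powi ?n < 2 * L"
    unfolding eq using assms by (simp add: less_log_iff)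
qed

lemma interval_subset_adjacent_dyadic:
  assumes "I \<in> bounded_intervals"
  obtains n k :: int where
    "2 powi n < 2 * measure lebesgue I"
    "I \<subseteq> {(of_int k - 1) * 2 powi n..<of_int k * 2 powi n}
           \<union> {of_int k * 2 powi n..<(of_int k + 1) * 2 powi n}"
proof -
  let ?L = "measure lebesgue I"
  obtain a where a: "I \<subseteq> {a..a + ?L}"
    using bounded_interval_subset_Icc[OF assms] .
  have "0 < ?L"
    using assms by (simp add: bounded_intervals_def)
  then obtain n :: int where n: "?L \<le> 2 powi n" "2 powi n < 2 * ?L"
    using power_of_two_between by blast
  \<comment> \<open>The point \<open>a\<close> lies in the left dyadic interval, whose index is \<open>k - 1\<close>.\<close>
  define k where "k = \<lfloor>a / 2 powi n\<rfloor> + 1"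
  have "of_int k - 1 \<le> a / 2 powi n" "a / 2 powi n < of_int k"
    unfolding k_def by linarith+
  then have "(of_int k - 1) * 2 powi n \<le> a" "a < of_int k * 2 powi n"
    by (simp_all add: field_simps)
  then have "I \<subseteq> {(of_int k - 1) * 2 powi n..<of_int k * 2 powi n}
                   \<union> {of_int k * 2 powi n..<(of_int k + 1) * 2 powi n}"
    using a n(1) by (force simp: algebra_simps)
  then show ?thesis
    using that n(2) by blast
qed

section \<open>Comparison of the two norms\<close>

text \<open>
  With \<open>h\<close> the common length of the two dyadic intervals \<open>J\<close> and \<open>K\<close> covering \<open>I\<close>, the integral
  of \<open>\<bar>\<phi> - \<phi>\<^sub>J\<bar>\<close> is at most \<open>h r\<close> over \<open>J\<close> and at most \<open>h r + 2 h r\<close> over \<open>K\<close>. The total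
  \<open>4 h r\<close> becomes \<open>16 r\<close> on using \<open>h \<le> 2 \<bar>I\<bar>\<close> and the factor \<open>2\<close> lost in replacing the
  average over \<open>I\<close> by \<open>\<phi>\<^sub>J\<close>.
\<close>

lemma mean_oscillation_le_dyadic:
  assumes loc: "locally_integrable \<phi>"
    and osc: "\<And>J. J \<in> dyadic_intervals \<Longrightarrow> mean_oscillation J \<phi> \<le> r"
    and adj: "\<And>n k :: int. 1 / 2 powi (n + 1) *
       \<bar>(LINT x:{(of_int k - 1) * 2 powi n .. of_int k * 2 powi n}|lebesgue. \<phi> x)
        - (LINT x:{of_int k * 2 powi n .. (of_int k + 1) * 2 powi n}|lebesgue. \<phi> x)\<bar> \<le> r"
    and I: "I \<in> bounded_intervals"
  shows "mean_oscillation I \<phi> \<le> 16 * r"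
proof -
  obtain n k :: int where n: "2 powi n < 2 * measure lebesgue I"
    and sub: "I \<subseteq> {(of_int k - 1) * 2 powi n..<of_int k * 2 powi n}
                    \<union> {of_int k * 2 powi n..<(of_int k + 1) * 2 powi n}"
    using interval_subset_adjacent_dyadic[OF I] .
  define h :: real where "h = 2 powi n"
  define J where "J = {(of_int k - 1) * h..<of_int k * h}"
  define K where "K = {of_int k * h..<(of_int k + 1) * h}"
  define c where "c = interval_average J \<phi>"
  define d where "d = interval_average K \<phi>"
  have h: "0 < h"
    by (simp add: h_def)
  have mI: "0 < measure lebesgue I"
    using I by (simp add: bounded_intervals_def)
  have JK: "J \<in> lmeasurable" "K \<in> lmeasurable" "bounded J" "bounded K"
    by (auto simp: J_def K_def intro: measurable_convex)
  have mJK: "measure lebesgue J = h" "measure lebesgue K = h"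
    using h by (simp_all add: J_def K_def algebra_simps)
  have int: "set_integrable lebesgue S \<phi>" if "S \<in> lmeasurable" "bounded S" for S
    using that loc by (intro locally_integrable_bounded) (auto simp: fmeasurable_def)
  have "J = {of_int (k - 1) * 2 powi n..<(of_int (k - 1) + 1) * 2 powi n}"
    by (simp add: J_def h_def)
  then have "J \<in> dyadic_intervals"
    unfolding dyadic_intervals_def by blast
  then have oJ: "(LINT x:J|lebesgue. \<bar>\<phi> x - c\<bar>) \<le> h * r"
    using osc[of J] h by (simp add: mean_oscillation_alt mJK c_def field_simps)
  have "K \<in> dyadic_intervals"
    unfolding dyadic_intervals_def K_def h_def by blast
  then have oK: "(LINT x:K|lebesgue. \<bar>\<phi> x - d\<bar>) \<le> h * r"
    using osc[of K] h by (simp add: mean_oscillation_alt mJK d_def field_simps)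
  have "h * c = (LINT x:J|lebesgue. \<phi> x)" "h * d = (LINT x:K|lebesgue. \<phi> x)"
    using h by (simp_all add: c_def d_def interval_average_def mJK)
  then have "1 / (2 * h) * \<bar>h * c - h * d\<bar> \<le> r"
    using adj[of n k]
    unfolding set_integral_Icc_eq_Ico
    by (simp add: J_def K_def h_def power_int_add mult.commute[of _ 2])
  moreover have "\<bar>h * c - h * d\<bar> = h * \<bar>d - c\<bar>"
    using h by (metis abs_minus_commute abs_mult abs_of_pos right_diff_distrib)
  ultimately have cd: "h * \<bar>d - c\<bar> \<le> 2 * h * r"
    using h by (simp add: field_simps)
  have "(LINT x:I|lebesgue. \<bar>\<phi> x - c\<bar>) \<le> (LINT x:J \<union> K|lebesgue. \<bar>\<phi> x - c\<bar>)"
    using sub bounded_intervals_lmeasurable[OF I] JK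
    by (intro set_integral_mono_subset set_integrable_abs_diff_const int)
       (auto simp: J_def K_def h_def)
  also have "\<dots> = (LINT x:J|lebesgue. \<bar>\<phi> x - c\<bar>) + (LINT x:K|lebesgue. \<bar>\<phi> x - c\<bar>)"
    using JK by (intro set_integral_Un set_integrable_abs_diff_const int)
      (auto simp: J_def K_def)
  also have "\<dots> \<le> 4 * h * r"
    using oJ oK cd set_integral_abs_diff_triangle[OF int[OF JK(2,4)] JK(2), of c d] mJK
    by simp
  finally have *: "(LINT x:I|lebesgue. \<bar>\<phi> x - c\<bar>) \<le> 4 * h * r" .
  have "0 \<le> h * \<bar>d - c\<bar>"
    using h by simp
  then have "0 \<le> 2 * h * r"
    using cd by (rule order_trans)
  then have r: "0 \<le> r"
    using h by (simp add: zero_le_mult_iff)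
  have "mean_oscillation I \<phi> \<le> 2 / measure lebesgue I * (LINT x:I|lebesgue. \<bar>\<phi> x - c\<bar>)"
    using I bounded_intervals_lmeasurable[OF I] mI
    by (intro mean_oscillation_le_any_constant int) (auto simp: bounded_intervals_def)
  also have "\<dots> \<le> 2 / measure lebesgue I * (4 * h * r)"
    using * mI by (intro mult_left_mono) auto
  also have "\<dots> \<le> 2 / measure lebesgue I * (4 * (2 * measure lebesgue I) * r)"
    using n mI r by (intro mult_left_mono mult_right_mono) (auto simp: h_def)
  also have "\<dots> = 16 * r"
    using mI by simp
  finally show ?thesis .
qed

lemma BMO_imp_Lambda:
  assumes "\<phi> \<in> BMO"
  shows "\<phi> \<in> Lambda_space" "Lambda_norm \<phi> \<le> bmo_norm \<phi>"
proof -
  have loc: "locally_integrable \<phi>" and fin: "bmo_norm \<phi> < \<infinity>"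
    using assms by (simp_all add: BMO_def)
  have dyadic: "dyadic_bmo_norm \<phi> \<le> bmo_norm \<phi>"
    unfolding dyadic_bmo_norm_def bmo_norm_def
    by (rule SUP_subset_mono[OF dyadic_intervals_subset_bounded_intervals]) simp
  have "ennreal (1 / 2 powi (n + 1) *
       \<bar>(LINT x:{(of_int k - 1) * 2 powi n .. of_int k * 2 powi n}|lebesgue. \<phi> x)
        - (LINT x:{of_int k * 2 powi n .. (of_int k + 1) * 2 powi n}|lebesgue. \<phi> x)\<bar>)
      \<le> bmo_norm \<phi>" (is "ennreal ?A \<le> _") for n k :: int
  proof -
    define h :: real where "h = 2 powi n"
    define S where "S = {of_int k * h - h..<of_int k * h + h}"
    have h: "0 < h"
      by (simp add: h_def)
    have "?A \<le> mean_oscillation S \<phi>"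
      using adjacent_diff_le_mean_oscillation[OF loc h, of "of_int k * h"]
      by (simp add: S_def h_def power_int_add algebra_simps)
    then have "ennreal ?A \<le> ennreal (mean_oscillation S \<phi>)"
      by (rule ennreal_leI)
    also have "\<dots> \<le> bmo_norm \<phi>"
      unfolding bmo_norm_def S_def using h by (intro SUP_upper Ico_in_bounded_intervals) simp
    finally show ?thesis .
  qed
  then have adjacent: "adjacent_diff \<phi> \<le> bmo_norm \<phi>"
    unfolding adjacent_diff_def by (intro SUP_least) auto
  show "Lambda_norm \<phi> \<le> bmo_norm \<phi>"
    using dyadic adjacent by (simp add: Lambda_norm_def)
  show "\<phi> \<in> Lambda_space"
    using dyadic adjacent fin loc
    by (auto simp: Lambda_space_def dyadic_BMO_def intro: le_less_trans)
qed

lemma Lambda_imp_BMO: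
  assumes "\<phi> \<in> Lambda_space"
  shows "\<phi> \<in> BMO" "bmo_norm \<phi> \<le> ennreal 16 * Lambda_norm \<phi>"
proof -
  have loc: "locally_integrable \<phi>" and fin: "Lambda_norm \<phi> < \<infinity>"
    using assms by (simp_all add: Lambda_space_def dyadic_BMO_def Lambda_norm_def)
  define r where "r = enn2real (Lambda_norm \<phi>)"
  have r: "Lambda_norm \<phi> = ennreal r" "0 \<le> r"
    using fin by (simp_all add: r_def)
  have "mean_oscillation I \<phi> \<le> 16 * r" if "I \<in> bounded_intervals" for I
  proof (rule mean_oscillation_le_dyadic[OF loc _ _ that])
    fix J assume "J \<in> dyadic_intervals"
    then have "ennreal (mean_oscillation J \<phi>) \<le> dyadic_bmo_norm \<phi>"
      unfolding dyadic_bmo_norm_def by (rule SUP_upper)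
    also have "\<dots> \<le> ennreal r"
      by (simp add: r(1)[symmetric] Lambda_norm_def)
    finally show "mean_oscillation J \<phi> \<le> r"
      using r(2) by (simp add: ennreal_le_iff)
  next
    fix n k :: int
    let ?A = "1 / 2 powi (n + 1) *
       \<bar>(LINT x:{(of_int k - 1) * 2 powi n .. of_int k * 2 powi n}|lebesgue. \<phi> x)
        - (LINT x:{of_int k * 2 powi n .. (of_int k + 1) * 2 powi n}|lebesgue. \<phi> x)\<bar>"
    have "ennreal ?A \<le> adjacent_diff \<phi>"
      unfolding adjacent_diff_def by (rule SUP_upper2[of "(n, k)"]) auto
    also have "\<dots> \<le> ennreal r"
      by (simp add: r(1)[symmetric] Lambda_norm_def)
    finally show "?A \<le> r"
      using r(2) by (simp add: ennreal_le_iff)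
  qed
  then have "bmo_norm \<phi> \<le> ennreal (16 * r)"
    unfolding bmo_norm_def by (intro SUP_least ennreal_leI)
  also have "\<dots> = ennreal 16 * Lambda_norm \<phi>"
    using r by (simp add: ennreal_mult)
  finally show "bmo_norm \<phi> \<le> ennreal 16 * Lambda_norm \<phi>" .
  also have "\<dots> < \<infinity>"
    using r by (simp add: ennreal_mult_less_top)
  finally show "\<phi> \<in> BMO"
    using loc by (simp add: BMO_def)
qed

theorem theorem3p1:
  shows "BMO = Lambda_space
    \<and> (\<forall>\<phi>\<in>BMO. \<phi> \<in> Lambda_space \<and> Lambda_norm \<phi> \<le> bmo_norm \<phi>)
    \<and> (\<exists>c::real. 0 \<le> c \<and>
         (\<forall>\<phi>\<in>Lambda_space. \<phi> \<in> BMO \<and> bmo_norm \<phi> \<le> ennreal c * Lambda_norm \<phi>))"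
proof (intro conjI)
  show "BMO = Lambda_space"
    using BMO_imp_Lambda(1) Lambda_imp_BMO(1) by blast
  show "\<forall>\<phi>\<in>BMO. \<phi> \<in> Lambda_space \<and> Lambda_norm \<phi> \<le> bmo_norm \<phi>"
    using BMO_imp_Lambda by blast
  show "\<exists>c::real. 0 \<le> c \<and>
         (\<forall>\<phi>\<in>Lambda_space. \<phi> \<in> BMO \<and> bmo_norm \<phi> \<le> ennreal c * Lambda_norm \<phi>)"
    using Lambda_imp_BMO by (intro exI[of _ 16]) simp
qed

end
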